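(* Let $m > 1$ and $n \ge 1$ be integers, let $R$ be a ring with $\mathrm{char}(R) = m$, let $G$ be a group, and let $\pi$ be the set of primes dividing $m$ or $n$. If the group ring $RG$ is an $n$-UU ring, then $R$ is an $n$-UU ring and $G$ is a $\pi$-torsion group.
   Context: Rings are associative with identity, not necessarily commutative. A ring $S$ is $n$-UU if $u^n - 1$ is nilpotent for every unit $u$ of $S$. For a set $\pi$ of primes, a group $G$ is a $\pi$-torsion group if every element of $G$ has finite order and all prime divisors of that order lie in $\pi$. *)

theory Defs
  imports "HOL-Library.Poly_Mapping" "HOL-Computational_Algebra.Computational_Algebra"
begin

definition two_sided_unit :: "'a::ring_1 \<Rightarrow> bool" where
  "two_sided_unit u \<longleftrightarrow> (\<exists>v. u * v = 1 \<and> v * u = 1)"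

definition nilpotent :: "'a::ring_1 \<Rightarrow> bool" where
  "nilpotent a \<longleftrightarrow> (\<exists>k::nat. a ^ k = 0)"

definition n_UU :: "nat \<Rightarrow> 'a::ring_1 itself \<Rightarrow> bool" where
  "n_UU n R \<longleftrightarrow> (\<forall>u::'a. two_sided_unit u \<longrightarrow> nilpotent (u ^ n - 1))"

(* Groups are types of class group_add, i.e. the group operation, which need not be commutative,
   is written +. The k-th power of g is therefore g + ... + g (k summands). *)

definition group_pow :: "'g::group_add \<Rightarrow> nat \<Rightarrow> 'g" where
  "group_pow g k = ((+) g ^^ k) 0"

definition finite_order :: "'g::group_add \<Rightarrow> bool" where
  "finite_order g \<longleftrightarrow> (\<exists>k>0. group_pow g k = 0)"

(* Meaningful only for elements of finite order. *)
definition elt_order :: "'g::group_add \<Rightarrow> nat" where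
  "elt_order g = (LEAST k. k > 0 \<and> group_pow g k = 0)"

definition pi_torsion_group :: "nat set \<Rightarrow> 'g::group_add itself \<Rightarrow> bool" where
  "pi_torsion_group \<pi> G \<longleftrightarrow>
     (\<forall>g::'g. finite_order g \<and> (\<forall>p. prime p \<and> p dvd elt_order g \<longrightarrow> p \<in> \<pi>))"

(* The group ring RG: finitely supported functions from G to R. The ring structure that
   Poly_Mapping puts on this type has pointwise addition and the convolution product
   (f * g)(k) = sum of f(a) g(b) over k = a + b. *)
type_synonym ('r, 'g) group_ring = "'g \<Rightarrow>\<^sub>0 'r"

end

theory Submission
  imports Defs
begin

text \<open>
  Both conclusions come from testing the hypothesis on two families of units of the group ring.
  The constants \<open>single 0 u\<close> with \<open>u\<close> a unit of the coefficient ring give the first one, since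
  the coefficient ring embeds in the group ring.

  For the second one, the units are the group elements \<open>single g 1\<close>: by hypothesis the element
  \<open>x = single (n g) 1\<close> is unipotent, that is, \<open>x - 1\<close> is nilpotent. The key fact is that in a
  ring where \<open>m = 0\<close> every unipotent \<open>x\<close> satisfies \<open>x ^ (m ^ k) = 1\<close> for some \<open>k\<close>
  (lemma \<open>unipotent_power_eq_1\<close>). Hence \<open>g\<close> is killed by \<open>n * m ^ k\<close>, a positive number all of
  whose prime divisors divide \<open>m\<close> or \<open>n\<close>. This shows at once that \<open>g\<close> has finite order and
  that the primes dividing this order, a divisor of \<open>n * m ^ k\<close>, are of the required kind.
\<close>

lemma power_minus_1_eq:
  fixes x :: "'a::ring_1"
  shows "x ^ n - 1 = (x - 1) * (\<Sum>i<n. x ^ i)"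
proof (induction n)
  case (Suc n)
  have "x ^ Suc n - 1 = (x ^ n - 1) + (x - 1) * x ^ n"
    by (simp add: algebra_simps)
  then show ?case unfolding Suc.IH by (simp add: distrib_left)
qed simp

text \<open>
  With \<open>y = x ^ (m ^ j)\<close>, the factorization \<open>y ^ m - 1 = (y ^ (m - 1) + ... + 1) * (y - 1)\<close>
  gains a factor \<open>x - 1\<close> over \<open>y - 1\<close>: since \<open>m = 0\<close>, the sum equals
  \<open>(y ^ (m - 1) - 1) + ... + (1 - 1)\<close>, and each of these terms is a power of \<open>x\<close> minus \<open>1\<close>.
  The cofactor of \<open>x - 1\<close> is a sum of powers of \<open>x\<close> and so commutes with \<open>y - 1\<close>; this lets the
  factors be collected although the ring need not be commutative.
\<close>

lemma minus_1_power_divides_power_minus_1: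
  fixes x :: "'a::ring_1"
  assumes "of_nat m = (0::'a)"
  shows "\<exists>w. x ^ (m ^ j) - 1 = (x - 1) ^ Suc j * w"
proof (induction j)
  case 0
  show ?case by (auto intro: exI[of _ 1])
next
  case (Suc j)
  define y where "y = x ^ (m ^ j)"
  \<comment> \<open>\<open>u\<close> is the sum over \<open>i < m\<close> of the quotients of \<open>y ^ i - 1\<close> by \<open>x - 1\<close>.\<close>
  define u where "u = (\<Sum>i<m. \<Sum>l<m ^ j * i. x ^ l)"
  obtain w where w: "y - 1 = (x - 1) ^ Suc j * w"
    using Suc.IH by (auto simp: y_def)
  have "(\<Sum>i<m. y ^ i) = (\<Sum>i<m. y ^ i - 1)"
    using assms by (simp add: sum_subtractf)
  also have "\<dots> = (x - 1) * u"
    by (simp add: y_def u_def sum_distrib_left power_minus_1_eq flip: power_mult)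
  finally have gain: "(\<Sum>i<m. y ^ i) = (x - 1) * u" .
  have "u * y = y * u"
    by (simp add: u_def y_def sum_distrib_left sum_distrib_right add.commute flip: power_add)
  then have comm: "u * (y - 1) = (y - 1) * u"
    by (simp add: algebra_simps)
  have "x ^ (m ^ Suc j) - 1 = y ^ m - 1"
    by (simp add: y_def mult.commute flip: power_mult)
  also have "\<dots> = (\<Sum>i<m. y ^ i) * (y - 1)"
    unfolding power_minus_1_eq left_diff_distrib right_diff_distrib
    by (simp add: power_commutes sum_distrib_left sum_distrib_right)
  also have "\<dots> = (x - 1) * (u * (y - 1))"
    by (simp add: gain mult.assoc)
  also have "\<dots> = (x - 1) ^ Suc (Suc j) * (w * u)"
    unfolding comm by (simp add: w mult.assoc)
  finally show ?case by blast
qed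

lemma unipotent_power_eq_1:
  fixes x :: "'a::ring_1"
  assumes "of_nat m = (0::'a)" and "nilpotent (x - 1)"
  obtains k where "x ^ (m ^ k) = 1"
proof -
  obtain k where "(x - 1) ^ k = 0"
    using assms(2) by (auto simp: nilpotent_def)
  then have "x ^ (m ^ k) - 1 = 0"
    using minus_1_power_divides_power_minus_1[OF assms(1), of x k]
    by (auto simp: mult.assoc)
  then show ?thesis using that by simp
qed

lemma group_pow_0 [simp]: "group_pow g 0 = 0"
  and group_pow_Suc [simp]: "group_pow g (Suc k) = g + group_pow g k"
  by (simp_all add: group_pow_def)

lemma group_pow_add: "group_pow g (a + b) = group_pow g a + group_pow g b"
  by (induction a) (simp_all add: add.assoc)

lemma group_pow_mult_eq_0: "group_pow g a = 0 \<Longrightarrow> group_pow g (a * b) = 0"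
  by (induction b) (simp_all add: group_pow_add)

lemma elt_order_dvd:
  assumes "group_pow g k = 0" and "k > 0"
  shows "elt_order g dvd k"
proof -
  let ?d = "elt_order g"
  have d: "?d > 0" "group_pow g ?d = 0"
    using LeastI[of "\<lambda>k. k > 0 \<and> group_pow g k = 0" k] assms
    by (auto simp: elt_order_def)
  have "group_pow g (k mod ?d) = group_pow g (?d * (k div ?d) + k mod ?d)"
    using d(2) unfolding group_pow_add by (simp add: group_pow_mult_eq_0)
  then have "group_pow g (k mod ?d) = 0"
    using assms(1) by simp
  moreover have "k mod ?d < ?d"
    using d(1) by simp
  ultimately have "k mod ?d = 0"
    using not_less_Least[of "k mod ?d" "\<lambda>k. k > 0 \<and> group_pow g k = 0"]
    by (simp flip: elt_order_def)
  then show ?thesis by (simp add: dvd_eq_mod_eq_0)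
qed

lemma single_zero_power:
  "(Poly_Mapping.single (0::'g::monoid_add) (a::'r::ring_1)) ^ k = Poly_Mapping.single 0 (a ^ k)"
  by (induction k) (simp_all add: mult_single)

lemma single_one_power:
  "(Poly_Mapping.single (g::'g::group_add) (1::'r::ring_1)) ^ k
    = Poly_Mapping.single (group_pow g k) 1"
  by (induction k) (simp_all add: mult_single)

lemma of_nat_CHAR_poly_mapping:
  "of_nat (CHAR('r)) = (0 :: 'g::monoid_add \<Rightarrow>\<^sub>0 'r::ring_1)"
  by (simp flip: single_of_nat)

lemma n_UU_coefficient_ring:
  assumes "n_UU n TYPE(('r::ring_1, 'g::group_add) group_ring)"
  shows "n_UU n TYPE('r)"
  unfolding n_UU_def
proof (intro allI impI)
  fix u :: 'r
  let ?c = "Poly_Mapping.single (0::'g) :: 'r \<Rightarrow> _"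
  assume "two_sided_unit u"
  then obtain v where "u * v = 1" "v * u = 1"
    by (auto simp: two_sided_unit_def)
  then have "?c u * ?c v = 1" "?c v * ?c u = 1"
    by (simp_all add: mult_single)
  then have "nilpotent (?c u ^ n - 1)"
    using assms by (auto simp: n_UU_def two_sided_unit_def)
  moreover have "?c u ^ n - 1 = ?c (u ^ n - 1)"
    by (simp add: single_zero_power single_diff)
  ultimately obtain k where "?c ((u ^ n - 1) ^ k) = 0"
    by (auto simp: nilpotent_def single_zero_power)
  then have "(u ^ n - 1) ^ k = 0"
    by (metis lookup_single_eq lookup_zero)
  then show "nilpotent (u ^ n - 1)"
    by (auto simp: nilpotent_def)
qed

lemma n_UU_group_ring_group_pow_eq_0:
  fixes g :: "'g::group_add"
  assumes "n_UU n TYPE(('r::ring_1, 'g) group_ring)"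
  obtains k where "group_pow g (n * CHAR('r) ^ k) = 0"
proof -
  let ?x = "\<lambda>h. Poly_Mapping.single h (1::'r) :: ('r, 'g) group_ring"
  have "?x g * ?x (- g) = 1" "?x (- g) * ?x g = 1"
    by (simp_all add: mult_single)
  then have "nilpotent (?x g ^ n - 1)"
    using assms(1) by (auto simp: n_UU_def two_sided_unit_def)
  then obtain k where "(?x g ^ n) ^ (CHAR('r) ^ k) = 1"
    using unipotent_power_eq_1 of_nat_CHAR_poly_mapping by blast
  then have "?x g ^ (n * CHAR('r) ^ k) = 1"
    by (simp add: power_mult)
  then have "?x (group_pow g (n * CHAR('r) ^ k)) = ?x 0"
    by (simp add: single_one_power)
  then have "group_pow g (n * CHAR('r) ^ k) = 0"
    by (metis lookup_single_eq lookup_single_not_eq zero_neq_one)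
  then show ?thesis using that by blast
qed

theorem theorem2p42:
  fixes m n :: nat
  assumes "m > 1" and "n \<ge> 1"
    and "CHAR('r::ring_1) = m"
    and "n_UU n TYPE(('r, 'g::group_add) group_ring)"
  shows "n_UU n TYPE('r) \<and>
    pi_torsion_group {p. prime p \<and> (p dvd m \<or> p dvd n)} TYPE('g)"
proof
  show "n_UU n TYPE('r)"
    using assms(4) by (rule n_UU_coefficient_ring)
  show "pi_torsion_group {p. prime p \<and> (p dvd m \<or> p dvd n)} TYPE('g)"
    unfolding pi_torsion_group_def
  proof (intro allI conjI impI)
    fix g :: 'g
    obtain k where k: "group_pow g (n * m ^ k) = 0"
      using n_UU_group_ring_group_pow_eq_0[OF assms(4)] assms(3) by blast
    have pos: "n * m ^ k > 0"
      using assms(1,2) by simp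
    show "finite_order g"
      unfolding finite_order_def using k pos by blast
    fix p :: nat
    assume p: "prime p \<and> p dvd elt_order g"
    then have "p dvd n * m ^ k"
      using elt_order_dvd[OF k pos] dvd_trans by blast
    then show "p \<in> {p. prime p \<and> (p dvd m \<or> p dvd n)}"
      using p by (auto simp: prime_dvd_mult_iff dest: prime_dvd_power)
  qed
qed

end
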